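(* Let $f\in\mathrm{RES}(-\gamma)$ with $\gamma\in[0,1)$. Then, for all $d\in\mathbb{N}$ and $A>0$ such that $$A<\frac{1}{4d\log(t)}\sqrt{\frac{\mathbb{E}V_t(f)}{1-\gamma}},$$ we have $$\left|\hat P_t(d,f)-\frac{\mathbb{E}\left[V_t(f)\hat P_t(d,f)\right]}{\mathbb{E}V_t(f)}\right|\le A\cdot\frac{10d}{\sqrt{(1-\gamma)\,\mathbb{E}V_t(f)}}$$ with probability at least $1-3e^{-A^2/3}$.
   Context: Model. An edge-step function is a function $f:[1,\infty)\to[0,1]$. Let $(Z_t)_{t\ge 1}$ be independent with $Z_t\sim\mathrm{Ber}(f(t))$. The random multigraph process $(G_t(f))_{t\ge1}$, indexed by discrete time $t$, starts with $G_1$ = one vertex with one loop. Given $G_t(f)$, if $Z_{t+1}=1$ perform a vertex-step: add a new vertex $v$ and an edge $\{u,v\}$, where the existing vertex $u$ is chosen with probability proportional to its degree in $G_t(f)$. If $Z_{t+1}=0$ perform an edge-step: add an edge $\{u_1,u_2\}$, where $u_1,u_2$ are chosen independently among existing vertices, each with probability proportional to its degree in $G_t(f)$ (loops and parallel edges allowed). A loop contributes $2$ to the degree, so the total degree of $G_t(f)$ is $2t$. $V_t(f)$ is the number of vertices of $G_t(f)$, and $\hat P_t(d,f)$ is the (random) proportion of vertices of $G_t(f)$ having degree exactly $d$. A positive function $g$ is regularly varying (at infinity) with index $\rho$ if $\lim_{t\to\infty}g(at)/g(t)=a^\rho$ for all $a>0$. $\mathrm{RES}(-\gamma)$ is the set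 of continuous functions $f:[1,\infty)\to[0,1]$ that decrease monotonically to $0$ at infinity and are regularly varying with index $-\gamma$. *)

theory Defs
  imports "HOL-Probability.Probability"
begin

definition regularly_varying :: "real \<Rightarrow> (real \<Rightarrow> real) \<Rightarrow> bool" where
  "regularly_varying \<rho> g \<longleftrightarrow>
     (\<forall>x\<ge>1. g x > 0) \<and>
     (\<forall>a>0. ((\<lambda>x. g (a * x) / g x) \<longlongrightarrow> a powr \<rho>) at_top)"

text \<open>A function \<open>[1, \<infinity>) \<rightarrow> [0, 1]\<close> is a total function on the reals whose values below 1 are
  never constrained. Monotonicity is not required to be strict.\<close>

definition RES :: "real \<Rightarrow> (real \<Rightarrow> real) set" where
  "RES \<rho> = {f. (\<forall>x\<ge>1. f x \<in> {0..1}) \<and> continuous_on {1..} f \<and> antimono_on {1..} f \<and>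
              (f \<longlongrightarrow> 0) at_top \<and> regularly_varying \<rho> f}"

text \<open>An edge is the two-element multiset of its endpoints, so a loop at \<open>u\<close> is \<open>{#u, u#}\<close>
  and contributes 2 to the degree of \<open>u\<close>; the edges form a multiset, so parallel edges are
  allowed.\<close>

datatype mgraph = MGraph (verts: "nat set") (edges: "nat multiset multiset")

definition degree :: "mgraph \<Rightarrow> nat \<Rightarrow> nat" where
  "degree G v = (\<Sum>e\<in>#edges G. count e v)"

definition total_degree :: "mgraph \<Rightarrow> nat" where
  "total_degree G = (\<Sum>v\<in>verts G. degree G v)"

definition num_verts :: "mgraph \<Rightarrow> nat" where
  "num_verts G = card (verts G)"

definition degree_proportion :: "nat \<Rightarrow> mgraph \<Rightarrow> real" where
  "degree_proportion d G = real (card {v \<in> verts G. degree G v = d}) / real (num_verts G)"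

text \<open>The density below has total mass 1 only if \<open>verts G\<close> is finite and \<open>total_degree G\<close> is
  positive; by \<open>edge_step_graph_invariant\<close> this holds for every graph the process reaches.\<close>

definition pref_vertex :: "mgraph \<Rightarrow> nat pmf" where
  "pref_vertex G =
     embed_pmf (\<lambda>v. if v \<in> verts G then real (degree G v) / real (total_degree G) else 0)"

text \<open>Vertices are numbered by order of arrival, so \<open>num_verts G\<close> is a fresh label.\<close>

definition vertex_step :: "mgraph \<Rightarrow> mgraph pmf" where
  "vertex_step G =
     do { u \<leftarrow> pref_vertex G;
          let v = num_verts G;
          return_pmf (MGraph (insert v (verts G)) (add_mset {#u, v#} (edges G))) }"

definition edge_step :: "mgraph \<Rightarrow> mgraph pmf" where
  "edge_step G =
     do { u\<^sub>1 \<leftarrow> pref_vertex G;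
          u\<^sub>2 \<leftarrow> pref_vertex G;
          return_pmf (MGraph (verts G) (add_mset {#u\<^sub>1, u\<^sub>2#} (edges G))) }"

definition initial_graph :: mgraph where
  "initial_graph = MGraph {0} {#{#0, 0#}#}"

text \<open>\<open>edge_step_graph f t\<close> is the law of the multigraph at time \<open>t \<ge> 1\<close>; the value at
  \<open>t = 0\<close> is a dummy. Drawing \<open>z\<close> afresh at each time makes the coins independent.\<close>

fun edge_step_graph :: "(real \<Rightarrow> real) \<Rightarrow> nat \<Rightarrow> mgraph pmf" where
  "edge_step_graph f 0 = return_pmf initial_graph"
| "edge_step_graph f (Suc 0) = return_pmf initial_graph"
| "edge_step_graph f (Suc (Suc t)) =
     do { G \<leftarrow> edge_step_graph f (Suc t);
          z \<leftarrow> bernoulli_pmf (f (real (Suc (Suc t))));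
          if z then vertex_step G else edge_step G }"

definition expected_num_verts :: "(real \<Rightarrow> real) \<Rightarrow> nat \<Rightarrow> real" where
  "expected_num_verts f t =
     measure_pmf.expectation (edge_step_graph f t) (\<lambda>G. real (num_verts G))"

lemma pmf_pref_vertex:
  assumes "finite (verts G)" "total_degree G > 0"
  shows "pmf (pref_vertex G) v =
           (if v \<in> verts G then real (degree G v) / real (total_degree G) else 0)"
proof -
  let ?p = "\<lambda>v. if v \<in> verts G then real (degree G v) / real (total_degree G) else 0"
  have "(\<integral>\<^sup>+v. ennreal (?p v) \<partial>count_space UNIV) = (\<Sum>v\<in>verts G. ennreal (?p v))"
    using assms(1) by (intro nn_integral_count_space') auto
  also have "\<dots> = ennreal (\<Sum>v\<in>verts G. ?p v)"
    by (rule sum_ennreal) auto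
  also have "(\<Sum>v\<in>verts G. ?p v) = real (total_degree G) / real (total_degree G)"
    by (simp add: total_degree_def flip: sum_divide_distrib)
  also have "\<dots> = 1"
    using assms(2) by simp
  finally show ?thesis
    unfolding pref_vertex_def by (subst pmf_embed_pmf) auto
qed

lemma set_pref_vertex:
  assumes "finite (verts G)" "total_degree G > 0"
  shows "set_pmf (pref_vertex G) \<subseteq> verts G"
  by (auto simp: set_pmf_iff pmf_pref_vertex[OF assms] split: if_splits)

lemma total_degree_add_edge:
  assumes "finite V" "verts G \<subseteq> V" "\<forall>e\<in>#edges G. set_mset e \<subseteq> verts G" "u \<in> V" "w \<in> V"
  shows "total_degree (MGraph V (add_mset {#u, w#} (edges G))) = total_degree G + 2"
proof -
  have "degree G v = 0" if "v \<notin> verts G" for v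
    using that assms(3) by (auto simp: degree_def count_eq_zero_iff)
  then have "(\<Sum>v\<in>V. degree G v) = total_degree G"
    unfolding total_degree_def using assms(1,2) by (intro sum.mono_neutral_right) auto
  moreover have "degree (MGraph V (add_mset {#u, w#} (edges G))) v =
      degree G v + (if v = u then 1 else 0) + (if v = w then 1 else 0)" for v
    by (auto simp: degree_def)
  ultimately show ?thesis
    using assms by (simp add: total_degree_def[of "MGraph _ _"] sum.distrib)
qed

lemma edge_step_graph_invariant:
  assumes "t \<ge> 1" "G \<in> set_pmf (edge_step_graph f t)"
  shows "verts G = {..<num_verts G}" "num_verts G \<ge> 1"
    "\<forall>e\<in>#edges G. set_mset e \<subseteq> verts G \<and> size e = 2"
    "total_degree G = 2 * t"
proof -
  have "verts G = {..<num_verts G} \<and> num_verts G \<ge> 1 \<and>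
    (\<forall>e\<in>#edges G. set_mset e \<subseteq> verts G \<and> size e = 2) \<and> total_degree G = 2 * t"
    using assms
  proof (induction t arbitrary: G rule: nat_induct_at_least)
    case base
    then show ?case
      by (auto simp: initial_graph_def num_verts_def total_degree_def degree_def)
  next
    case (Suc t)
    obtain s where s: "t = Suc s"
      using Suc.hyps by (cases t) auto
    from Suc.prems obtain H where H: "H \<in> set_pmf (edge_step_graph f t)"
      and G: "G \<in> set_pmf (vertex_step H) \<or> G \<in> set_pmf (edge_step H)"
      by (auto simp: s split: if_splits)
    note IH = Suc.IH[OF H]
    have fin: "finite (verts H)"
      using IH by (metis finite_lessThan)
    have pos: "total_degree H > 0"
      using IH Suc.hyps by simp
    note sub = set_pref_vertex[OF fin pos]
    from G show ?case
    proof
      assume "G \<in> set_pmf (vertex_step H)"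
      then obtain u where u: "u \<in> verts H"
        and G: "G = MGraph (insert (num_verts H) (verts H))
                      (add_mset {#u, num_verts H#} (edges H))"
        using sub by (auto simp: vertex_step_def Let_def)
      have v: "insert (num_verts H) (verts H) = {..<Suc (num_verts H)}"
        using IH by (metis lessThan_Suc)
      have "total_degree G = total_degree H + 2"
        unfolding G using IH fin u by (intro total_degree_add_edge) auto
      moreover have "num_verts G = Suc (num_verts H)"
        unfolding num_verts_def[of G] by (simp add: G v)
      ultimately show ?thesis
        using IH u by (auto simp: G v[symmetric] lessThan_Suc)
    next
      assume "G \<in> set_pmf (edge_step H)"
      then obtain u w where u: "u \<in> verts H" "w \<in> verts H"
        and G: "G = MGraph (verts H) (add_mset {#u, w#} (edges H))"
        using sub by (auto simp: edge_step_def)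
      have "total_degree G = total_degree H + 2"
        unfolding G using IH fin u by (intro total_degree_add_edge) auto
      moreover have "num_verts G = num_verts H"
        by (simp add: G num_verts_def)
      ultimately show ?thesis
        using IH u by (auto simp: G)
    qed
  qed
  then show "verts G = {..<num_verts G}" "num_verts G \<ge> 1"
    "\<forall>e\<in>#edges G. set_mset e \<subseteq> verts G \<and> size e = 2" "total_degree G = 2 * t"
    by auto
qed

end

(* The number N of vertices of degree d is a linear functional of the degree sequence, so with
   g_s(k) the probability that a vertex of degree k at time s ends with degree d, its Doob
   martingale is explicit: a sum of g_s(degree v) over the present vertices plus a deterministic
   term for the vertices still to come. A vertex-step changes it by at most 2 and has probability
   f(s + 1). In an edge-step a vertex of degree k is chosen with probability about k / s and
   changes it by at most max g <= d (s/t)^(1/4) / k; the resulting conditional variance is at most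
   2 d^2 sqrt((s + 1)/t) / s times the number V of vertices, and summing over s gives at most
   8 d^2 V. Applied to N - r V with r = E N / E V, this yields a Freedman-type tail bound at scale
   d sqrt(E V), and V is at least E V / 2 up to an exponentially small probability. *)

theory Submission
  imports Defs
begin

section \<open>Expectations of finitely supported distributions\<close>

lemma expectation_bind_pmf_finite:
  fixes h :: "'b \<Rightarrow> real"
  assumes "finite (set_pmf p)" "\<And>x. x \<in> set_pmf p \<Longrightarrow> finite (set_pmf (q x))"
  shows "measure_pmf.expectation (p \<bind> q) h =
           measure_pmf.expectation p (\<lambda>x. measure_pmf.expectation (q x) h)"
  using assms
  by (subst pmf_expectation_bind[of "set_pmf p"])
     (auto simp: integral_measure_pmf_real[of "set_pmf p"] mult.commute intro!: sum.cong)

lemma expectation_mono_finite: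
  fixes g h :: "'a \<Rightarrow> real"
  assumes "finite (set_pmf p)" "\<And>x. x \<in> set_pmf p \<Longrightarrow> g x \<le> h x"
  shows "measure_pmf.expectation p g \<le> measure_pmf.expectation p h"
  using assms by (intro integral_mono_AE) (auto intro: integrable_measure_pmf_finite AE_pmfI)

text \<open>For negative \<open>x = - y\<close>, dividing by \<open>exp x\<close> and using
  \<open>exp y >= 1 + y + y^2 / 2\<close> leaves a product of two quadratics, which expands to 1
  plus positive terms.\<close>

lemma exp_le_quadratic:
  fixes x :: real
  assumes "x \<le> 1"
  shows "exp x \<le> 1 + x + x\<^sup>2"
proof (cases "x \<ge> 0")
  case True
  with assms show ?thesis by (intro exp_bound)
next
  case False
  define y where "y = - x"
  with False have y: "y > 0" by simp
  have "1 \<le> (1 - y + y\<^sup>2) * (1 + y + y\<^sup>2 / 2)"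
  proof -
    have "(1 - y + y\<^sup>2) * (1 + y + y\<^sup>2 / 2) = 1 + y ^ 2 / 2 + y ^ 3 / 2 + y ^ 4 / 2"
      by (simp add: field_simps power2_eq_square power3_eq_cube power4_eq_xxxx)
    then show ?thesis using y by simp
  qed
  also have "\<dots> \<le> (1 - y + y\<^sup>2) * exp y"
  proof (rule mult_left_mono)
    have "1 - y + y\<^sup>2 = (1/2 - y)\<^sup>2 + 3/4" by (simp add: power2_eq_square algebra_simps)
    then show "0 \<le> 1 - y + y\<^sup>2" by simp
  qed (use y exp_lower_Taylor_quadratic[of y] in simp)
  finally show ?thesis
    by (simp add: y_def exp_minus field_simps)
qed

text \<open>After centring, the linear term of \<open>exp_le_quadratic\<close> averages to zero, and
  the variance is at most the second moment. Both \<open>Y\<close> and its mean are at most 2 in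
  absolute value, so \<open>Y\<close> deviates from the mean by at most 4; hence the restriction on
  \<theta>.\<close>

lemma centred_mgf_bound:
  fixes Y :: "'a \<Rightarrow> real"
  assumes fin: "finite (set_pmf q)"
    and Y: "\<And>x. x \<in> set_pmf q \<Longrightarrow> \<bar>Y x\<bar> \<le> 2"
    and \<theta>: "\<bar>\<theta>\<bar> \<le> 1 / 4"
    and S: "measure_pmf.expectation q (\<lambda>x. (Y x)\<^sup>2) \<le> S"
  shows "measure_pmf.expectation q (\<lambda>x. exp (\<theta> * (Y x - measure_pmf.expectation q Y)))
           \<le> exp (\<theta>\<^sup>2 * S)"
proof -
  let ?E = "measure_pmf.expectation q"
  define m where "m = ?E Y"
  note int = integrable_measure_pmf_finite[OF fin]
  have "?E Y \<le> ?E (\<lambda>_. 2)" "?E (\<lambda>_. - 2) \<le> ?E Y"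
    using Y by (intro expectation_mono_finite fin; fastforce simp: abs_le_iff)+
  then have m: "\<bar>m\<bar> \<le> 2" by (simp add: m_def)
  have "?E (\<lambda>x. exp (\<theta> * (Y x - m)))
      \<le> ?E (\<lambda>x. 1 + \<theta> * (Y x - m) + (\<theta> * (Y x - m))\<^sup>2)"
  proof (intro expectation_mono_finite fin exp_le_quadratic)
    fix x assume "x \<in> set_pmf q"
    then have "\<bar>Y x - m\<bar> \<le> 4" using Y[of x] m by auto
    then have "\<bar>\<theta>\<bar> * \<bar>Y x - m\<bar> \<le> 1 / 4 * 4" using \<theta> by (intro mult_mono) auto
    then show "\<theta> * (Y x - m) \<le> 1" by (simp add: abs_mult[symmetric])
  qed
  also have "(\<lambda>x. 1 + \<theta> * (Y x - m) + (\<theta> * (Y x - m))\<^sup>2) =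
      (\<lambda>x. \<theta>\<^sup>2 * (Y x)\<^sup>2 + (\<theta> - 2 * m * \<theta>\<^sup>2) * Y x + (1 - \<theta> * m + \<theta>\<^sup>2 * m\<^sup>2))"
    by (auto simp: power2_eq_square algebra_simps)
  also have "?E \<dots> = \<theta>\<^sup>2 * ?E (\<lambda>x. (Y x)\<^sup>2) + (\<theta> - 2 * m * \<theta>\<^sup>2) * m
      + (1 - \<theta> * m + \<theta>\<^sup>2 * m\<^sup>2)"
    by (simp add: int m_def)
  also have "\<dots> = 1 + \<theta>\<^sup>2 * ?E (\<lambda>x. (Y x)\<^sup>2) - \<theta>\<^sup>2 * m\<^sup>2"
    by (simp add: power2_eq_square algebra_simps)
  also have "\<dots> \<le> 1 + \<theta>\<^sup>2 * S"
    using mult_left_mono[OF S, of "\<theta>\<^sup>2"] zero_le_square[of "\<theta> * m"]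
    by (simp add: power2_eq_square algebra_simps)
  also have "\<dots> \<le> exp (\<theta>\<^sup>2 * S)" by (rule exp_ge_add_one_self)
  finally show ?thesis by (simp add: m_def)
qed

section \<open>One step of the process\<close>

text \<open>The consequences of \<open>edge_step_graph_invariant\<close> from which the one-step
  formulas are derived; \<open>num_verts G \<notin> verts G\<close> says that the label of the next
  vertex is fresh.\<close>

definition admissible :: "nat \<Rightarrow> mgraph \<Rightarrow> bool" where
  "admissible s G \<longleftrightarrow> s \<ge> 1 \<and> finite (verts G) \<and> num_verts G \<notin> verts G \<and>
     (\<forall>e\<in>#edges G. set_mset e \<subseteq> verts G) \<and> total_degree G = 2 * s"

definition attach :: "mgraph \<Rightarrow> nat \<Rightarrow> mgraph" where
  "attach G u = MGraph (insert (num_verts G) (verts G)) (add_mset {#u, num_verts G#} (edges G))"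

definition connect :: "mgraph \<Rightarrow> nat \<Rightarrow> nat \<Rightarrow> mgraph" where
  "connect G u w = MGraph (verts G) (add_mset {#u, w#} (edges G))"

definition degree_sum :: "(nat \<Rightarrow> real) \<Rightarrow> mgraph \<Rightarrow> real" where
  "degree_sum c G = (\<Sum>v\<in>verts G. c (degree G v))"

definition pick_prob :: "nat \<Rightarrow> nat \<Rightarrow> real" where
  "pick_prob s k = real k / (2 * real s)"

lemma admissible_edge_step_graph:
  assumes "s \<ge> 1" "G \<in> set_pmf (edge_step_graph f s)"
  shows "admissible s G"
  unfolding admissible_def
  using edge_step_graph_invariant[OF assms] assms(1)
  by (metis finite_lessThan lessThan_iff less_irrefl)

context
  fixes s G
  assumes adm: "admissible s G"
begin

lemma adm_facts:
  "s \<ge> 1" "finite (verts G)" "num_verts G \<notin> verts G" "total_degree G = 2 * s"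
  "e \<in># edges G \<Longrightarrow> set_mset e \<subseteq> verts G"
  using adm by (auto simp: admissible_def)

lemma set_pref_vertex_adm: "set_pmf (pref_vertex G) \<subseteq> verts G"
  by (rule set_pref_vertex) (use adm_facts in auto)

lemma finite_pref_vertex: "finite (set_pmf (pref_vertex G))"
  using set_pref_vertex_adm adm_facts(2) by (rule finite_subset)

lemma expectation_pref_vertex:
  fixes h :: "nat \<Rightarrow> real"
  shows "measure_pmf.expectation (pref_vertex G) h =
           (\<Sum>v\<in>verts G. pick_prob s (degree G v) * h v)"
  using adm_facts set_pref_vertex_adm
  by (subst integral_measure_pmf_real[of "verts G"])
     (auto simp: pmf_pref_vertex pick_prob_def intro!: sum.cong)

lemma pick_prob_sum: "(\<Sum>v\<in>verts G. pick_prob s (degree G v)) = 1"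
  using expectation_pref_vertex[of "\<lambda>_. 1"] by simp

lemma degree_le: "v \<in> verts G \<Longrightarrow> degree G v \<le> 2 * s"
  using member_le_sum[of v "verts G" "degree G"] adm_facts by (auto simp: total_degree_def)

lemma degree_pos: "v \<in> set_pmf (pref_vertex G) \<Longrightarrow> degree G v \<ge> 1"
  using adm_facts by (auto simp: set_pmf_iff pmf_pref_vertex split: if_splits)

lemma num_verts_attach: "num_verts (attach G u) = Suc (num_verts G)"
  using adm_facts by (simp add: attach_def num_verts_def[of "MGraph _ _"]) (simp add: num_verts_def)

lemma num_verts_connect: "num_verts (connect G u w) = num_verts G"
  by (simp add: connect_def num_verts_def)

lemma degree_attach:
  "u \<in> verts G \<Longrightarrow> degree (attach G u) v =
     (if v = num_verts G then 1 else degree G v + (if v = u then 1 else 0))"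
proof -
  assume u: "u \<in> verts G"
  have "degree G (num_verts G) = 0"
    using adm_facts(3,5) by (fastforce simp: degree_def count_eq_zero_iff)
  then show ?thesis using u adm_facts(3) by (auto simp: attach_def degree_def)
qed

lemma degree_connect:
  "degree (connect G u w) v = degree G v + (if v = u then 1 else 0) + (if v = w then 1 else 0)"
  by (auto simp: connect_def degree_def)

lemma degree_sum_attach:
  assumes u: "u \<in> verts G"
  shows "degree_sum c (attach G u) =
           degree_sum c G + (c (degree G u + 1) - c (degree G u)) + c 1"
proof -
  have "degree_sum c (attach G u) =
      c 1 + (\<Sum>v\<in>verts G. c (degree G v + (if v = u then 1 else 0)))"
    using adm_facts unfolding degree_sum_def degree_attach[OF u]
    by (auto simp: attach_def intro!: sum.cong)
  also have "(\<Sum>v\<in>verts G. c (degree G v + (if v = u then 1 else 0))) =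
      (\<Sum>v\<in>verts G. c (degree G v) + (if v = u then c (degree G u + 1) - c (degree G u) else 0))"
    by (intro sum.cong) auto
  finally show ?thesis
    using adm_facts u by (simp add: sum.distrib degree_sum_def)
qed

lemma degree_sum_connect:
  assumes u: "u \<in> verts G" "w \<in> verts G"
  shows "degree_sum c (connect G u w) = degree_sum c G +
           (if u = w then c (degree G u + 2) - c (degree G u)
            else (c (degree G u + 1) - c (degree G u)) + (c (degree G w + 1) - c (degree G w)))"
proof -
  have "degree_sum c (connect G u w) =
      (\<Sum>v\<in>verts G. c (degree G v + (if v = u then 1 else 0) + (if v = w then 1 else 0)))"
    unfolding degree_sum_def degree_connect by (simp add: connect_def)
  also have "\<dots> = (\<Sum>v\<in>verts G. c (degree G v) +
      (if u = w then (if v = u then c (degree G u + 2) - c (degree G u) else 0)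
       else (if v = u then c (degree G u + 1) - c (degree G u) else 0) +
            (if v = w then c (degree G w + 1) - c (degree G w) else 0)))"
    by (intro sum.cong) auto
  finally show ?thesis
    using adm_facts u by (cases "u = w") (simp_all add: sum.distrib degree_sum_def)
qed

lemma vertex_step_eq: "vertex_step G = map_pmf (attach G) (pref_vertex G)"
  by (simp add: vertex_step_def map_pmf_def attach_def Let_def)

lemma edge_step_eq:
  "edge_step G = pref_vertex G \<bind> (\<lambda>u. map_pmf (connect G u) (pref_vertex G))"
  by (simp add: edge_step_def map_pmf_def connect_def)

end

section \<open>One-step averages of additive functionals of the degrees\<close>

definition step :: "real \<Rightarrow> mgraph \<Rightarrow> mgraph pmf" where
  "step p G = bernoulli_pmf p \<bind> (\<lambda>z. if z then vertex_step G else edge_step G)"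

lemma edge_step_graph_Suc:
  "s \<ge> 1 \<Longrightarrow> edge_step_graph f (Suc s) = edge_step_graph f s \<bind> step (f (real (Suc s)))"
  by (cases s) (simp_all add: step_def[abs_def])

text \<open>The degree of a single vertex is itself a Markov chain: with \<open>x\<close> the chance
  that one endpoint hits the vertex, a vertex-step adds a Bernoulli variable and an edge-step a
  binomial one with two trials. This is the backward operator of that chain, applied to
  \<open>c\<close>.\<close>

definition degree_step :: "real \<Rightarrow> nat \<Rightarrow> (nat \<Rightarrow> real) \<Rightarrow> nat \<Rightarrow> real" where
  "degree_step p s c k = (let x = pick_prob s k in
     p * ((1 - x) * c k + x * c (k + 1)) +
     (1 - p) * ((1 - x)\<^sup>2 * c k + 2 * x * (1 - x) * c (k + 1) + x\<^sup>2 * c (k + 2)))"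

context
  fixes s G and p :: real
  assumes adm: "admissible s G" and p: "0 \<le> p" "p \<le> 1"
begin

lemma set_step:
  "H \<in> set_pmf (step p G) \<Longrightarrow>
     (\<exists>u\<in>set_pmf (pref_vertex G). H = attach G u) \<or>
     (\<exists>u\<in>set_pmf (pref_vertex G). \<exists>w\<in>set_pmf (pref_vertex G). H = connect G u w)"
  by (auto simp: step_def vertex_step_eq[OF adm] edge_step_eq[OF adm] split: if_splits)

lemma finite_set_step: "finite (set_pmf (step p G))"
proof (rule finite_subset)
  show "set_pmf (step p G) \<subseteq> attach G ` set_pmf (pref_vertex G) \<union>
      (\<Union>u\<in>set_pmf (pref_vertex G). connect G u ` set_pmf (pref_vertex G))"
    using set_step by blast
qed (use finite_pref_vertex[OF adm] in auto)

lemma expectation_step: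
  fixes h :: "mgraph \<Rightarrow> real"
  shows "measure_pmf.expectation (step p G) h =
     p * measure_pmf.expectation (pref_vertex G) (\<lambda>u. h (attach G u)) +
     (1 - p) * measure_pmf.expectation (pref_vertex G)
       (\<lambda>u. measure_pmf.expectation (pref_vertex G) (\<lambda>w. h (connect G u w)))"
proof -
  note fin = finite_pref_vertex[OF adm]
  have "measure_pmf.expectation (step p G) h =
      measure_pmf.expectation (bernoulli_pmf p)
        (\<lambda>z. measure_pmf.expectation (if z then vertex_step G else edge_step G) h)"
    unfolding step_def
    by (rule expectation_bind_pmf_finite)
       (auto simp: vertex_step_eq[OF adm] edge_step_eq[OF adm] fin finite_subset[OF subset_UNIV])
  moreover have "measure_pmf.expectation (vertex_step G) h =
      measure_pmf.expectation (pref_vertex G) (\<lambda>u. h (attach G u))"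
    by (simp add: vertex_step_eq[OF adm])
  moreover have "measure_pmf.expectation (edge_step G) h =
      measure_pmf.expectation (pref_vertex G)
       (\<lambda>u. measure_pmf.expectation (pref_vertex G) (\<lambda>w. h (connect G u w)))"
    unfolding edge_step_eq[OF adm] by (subst expectation_bind_pmf_finite) (auto simp: fin)
  ultimately show ?thesis using p by (simp add: mult.commute)
qed

lemma expectation_num_verts_step:
  "measure_pmf.expectation (step p G) (\<lambda>H. real (num_verts H)) = real (num_verts G) + p"
  by (simp add: expectation_step num_verts_attach[OF adm] num_verts_connect[OF adm] algebra_simps)

text \<open>By linearity every old vertex contributes the one-step average of its own chain, and a
  new vertex always enters with degree 1. Additive functionals thus stay additive, which makes the
  Doob martingale explicit.\<close>

lemma expectation_degree_sum_step:
  "measure_pmf.expectation (step p G) (degree_sum c) = degree_sum (degree_step p s c) G + p * c 1"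
proof -
  let ?V = "verts G" and ?k = "degree G"
  let ?x = "\<lambda>v. pick_prob s (?k v)"
  let ?\<delta> = "\<lambda>v. c (?k v + 1) - c (?k v)"
  \<comment> \<open>The second difference: what a loop at \<open>v\<close> contributes beyond two
    separate unit increments.\<close>
  let ?\<epsilon> = "\<lambda>v. c (?k v + 2) - 2 * c (?k v + 1) + c (?k v)"
  have fin: "finite ?V" by (rule adm_facts[OF adm])
  note X = pick_prob_sum[OF adm]
  have "(\<Sum>v\<in>?V. ?x v * degree_sum c (attach G v)) =
      (\<Sum>v\<in>?V. ?x v * (degree_sum c G + c 1) + ?x v * ?\<delta> v)"
    by (intro sum.cong refl) (simp add: degree_sum_attach[OF adm] algebra_simps)
  also have "\<dots> = degree_sum c G + c 1 + (\<Sum>v\<in>?V. ?x v * ?\<delta> v)"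
    by (simp add: sum.distrib X flip: sum_distrib_right)
  finally have 1: "(\<Sum>v\<in>?V. ?x v * degree_sum c (attach G v)) =
      degree_sum c G + c 1 + (\<Sum>v\<in>?V. ?x v * ?\<delta> v)" .
  have inner: "(\<Sum>w\<in>?V. ?x w * degree_sum c (connect G u w)) =
      degree_sum c G + ?\<delta> u + (\<Sum>w\<in>?V. ?x w * ?\<delta> w) + ?x u * ?\<epsilon> u" if u: "u \<in> ?V" for u
  proof -
    have "(\<Sum>w\<in>?V. ?x w * degree_sum c (connect G u w)) =
        (\<Sum>w\<in>?V. ?x w * (degree_sum c G + ?\<delta> u) + ?x w * ?\<delta> w +
           (if w = u then ?x u * ?\<epsilon> u else 0))"
      using u by (intro sum.cong refl) (auto simp: degree_sum_connect[OF adm] algebra_simps)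
    also have "\<dots> = degree_sum c G + ?\<delta> u + (\<Sum>w\<in>?V. ?x w * ?\<delta> w) + ?x u * ?\<epsilon> u"
      using u fin by (simp add: sum.distrib X flip: sum_distrib_right)
    finally show ?thesis .
  qed
  have "(\<Sum>u\<in>?V. ?x u * (\<Sum>w\<in>?V. ?x w * degree_sum c (connect G u w))) =
      (\<Sum>u\<in>?V. ?x u * (degree_sum c G + (\<Sum>w\<in>?V. ?x w * ?\<delta> w)) + ?x u * ?\<delta> u
         + (?x u)\<^sup>2 * ?\<epsilon> u)"
    by (intro sum.cong refl) (simp only: inner, simp only: distrib_left power2_eq_square ac_simps)
  also have "\<dots> = degree_sum c G + 2 * (\<Sum>v\<in>?V. ?x v * ?\<delta> v) + (\<Sum>v\<in>?V. (?x v)\<^sup>2 * ?\<epsilon> v)"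
    by (simp add: sum.distrib X flip: sum_distrib_right)
  finally have 2: "(\<Sum>u\<in>?V. ?x u * (\<Sum>w\<in>?V. ?x w * degree_sum c (connect G u w))) =
      degree_sum c G + 2 * (\<Sum>v\<in>?V. ?x v * ?\<delta> v) + (\<Sum>v\<in>?V. (?x v)\<^sup>2 * ?\<epsilon> v)" .
  have "degree_sum (degree_step p s c) G =
      (\<Sum>v\<in>?V. c (?k v) + p * (?x v * ?\<delta> v) + (1 - p) * (2 * (?x v * ?\<delta> v) + (?x v)\<^sup>2 * ?\<epsilon> v))"
    unfolding degree_sum_def
    by (intro sum.cong refl) (simp add: degree_step_def Let_def algebra_simps power2_eq_square)
  also have "\<dots> = degree_sum c G + p * (\<Sum>v\<in>?V. ?x v * ?\<delta> v) +
      (1 - p) * (2 * (\<Sum>v\<in>?V. ?x v * ?\<delta> v) + (\<Sum>v\<in>?V. (?x v)\<^sup>2 * ?\<epsilon> v))"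
    by (simp add: sum.distrib degree_sum_def flip: sum_distrib_left)
  finally show ?thesis
    by (simp add: expectation_step expectation_pref_vertex[OF adm] 1 2) (simp add: algebra_simps)
qed

end

section \<open>Increments of the martingale\<close>

context
  fixes s G and p b r :: real and c :: "nat \<Rightarrow> real"
  assumes adm: "admissible s G" and p: "0 \<le> p" "p \<le> 1" and r: "0 \<le> r" "r \<le> 1"
    and c01: "\<And>k. k \<le> 2 * Suc s \<Longrightarrow> 0 \<le> c k \<and> c k \<le> 1"
    and cb: "\<And>k. 1 \<le> k \<Longrightarrow> k \<le> 2 * Suc s \<Longrightarrow> c k \<le> b / real k"
begin

text \<open>Both graphs are weighted by the same \<open>c\<close>. When \<open>c\<close> is the
  weight of time \<open>Suc s\<close>, the martingale increment is \<open>Y\<close> minus its mean,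
  so bounds on the uncentred \<open>Y\<close> suffice for \<open>centred_mgf_bound\<close>.\<close>

private definition Y :: "mgraph \<Rightarrow> real" where
  "Y H = degree_sum c H - degree_sum c G - r * (real (num_verts H) - real (num_verts G))"

private lemma Y_attach:
  assumes u: "u \<in> set_pmf (pref_vertex G)"
  shows "\<bar>Y (attach G u)\<bar> \<le> 2"
proof -
  have v: "u \<in> verts G" using u set_pref_vertex_adm[OF adm] by auto
  show ?thesis
    using degree_le[OF adm v] c01[of "degree G u"] c01[of "degree G u + 1"] c01[of 1] r
    by (simp add: Y_def degree_sum_attach[OF adm v] num_verts_attach[OF adm] abs_le_iff)
qed

text \<open>The number of vertices does not change, so only the endpoints matter. At an endpoint of
  degree \<open>k\<close> the old and new weights both lie between 0 and
  \<open>min 1 (b / k)\<close>, hence so does the absolute value of their difference; a loop counts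
  as one endpoint jumping by 2.\<close>

private lemma Y_connect:
  assumes u: "u \<in> set_pmf (pref_vertex G)" and w: "w \<in> set_pmf (pref_vertex G)"
  shows "\<bar>Y (connect G u w)\<bar> \<le> 2"
    "\<bar>Y (connect G u w)\<bar> \<le> b / real (degree G u) + b / real (degree G w)"
proof -
  have uv: "u \<in> verts G" "w \<in> verts G" using u w set_pref_vertex_adm[OF adm] by auto
  have b: "b \<ge> 0" using cb[of 1] c01[of 1] by simp
  have small: "c (k + j) \<le> b / real k" if "1 \<le> k" "k + j \<le> 2 * Suc s" for k j
  proof -
    have "c (k + j) \<le> b / real (k + j)" using that by (intro cb) auto
    also have "\<dots> \<le> b / real k" using that b by (intro divide_left_mono) auto
    finally show ?thesis .
  qed
  have Y: "Y (connect G u w) =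
     (if u = w then c (degree G u + 2) - c (degree G u)
      else (c (degree G u + 1) - c (degree G u)) + (c (degree G w + 1) - c (degree G w)))"
    by (simp add: Y_def degree_sum_connect[OF adm uv] num_verts_connect[OF adm])
  have diff: "\<bar>c (degree G v + j) - c (degree G v)\<bar> \<le> 1"
       "\<bar>c (degree G v + j) - c (degree G v)\<bar> \<le> b / real (degree G v)"
    if "v \<in> set_pmf (pref_vertex G)" "j \<le> 2" for v j
  proof -
    have "degree G v \<le> 2 * s" "1 \<le> degree G v"
      using that set_pref_vertex_adm[OF adm] degree_le[OF adm] degree_pos[OF adm] by auto
    then show "\<bar>c (degree G v + j) - c (degree G v)\<bar> \<le> 1"
       "\<bar>c (degree G v + j) - c (degree G v)\<bar> \<le> b / real (degree G v)"
      using c01[of "degree G v + j"] c01[of "degree G v"]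
        small[of "degree G v" j] small[of "degree G v" 0] that(2)
      by (auto simp: abs_le_iff)
  qed
  have "b / real (degree G w) \<ge> 0" using b by simp
  then show "\<bar>Y (connect G u w)\<bar> \<le> 2"
    "\<bar>Y (connect G u w)\<bar> \<le> b / real (degree G u) + b / real (degree G w)"
    unfolding Y using diff[OF u, of 1] diff[OF w, of 1] diff[OF u, of 2] by auto
qed

lemma step_increment_bound:
  assumes "H \<in> set_pmf (step p G)"
  shows "\<bar>degree_sum c H - degree_sum c G - r * (real (num_verts H) - real (num_verts G))\<bar> \<le> 2"
  using set_step[OF adm p assms] Y_attach Y_connect(1) by (auto simp: Y_def)

text \<open>A vertex-step costs at most 4 but has probability only \<open>p\<close>. In an edge-step
  the increment is small at vertices of high degree, exactly those that are likely to be
  chosen.\<close>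

lemma step_increment_variance:
  "measure_pmf.expectation (step p G)
     (\<lambda>H. (degree_sum c H - degree_sum c G - r * (real (num_verts H) - real (num_verts G)))\<^sup>2)
   \<le> 4 * p + 2 * b\<^sup>2 / real s * real (num_verts G)"
proof -
  let ?P = "measure_pmf.expectation (pref_vertex G)"
  note fin = finite_pref_vertex[OF adm]
  note int = integrable_measure_pmf_finite[OF fin]
  define B where "B u = (b / real (degree G u))\<^sup>2" for u
  have s: "real s > 0" using adm_facts[OF adm] by simp
  have "?P (\<lambda>u. (Y (attach G u))\<^sup>2) \<le> ?P (\<lambda>u. 4)"
  proof (rule expectation_mono_finite[OF fin])
    fix u assume "u \<in> set_pmf (pref_vertex G)"
    from power_mono[OF Y_attach[OF this], of 2] show "(Y (attach G u))\<^sup>2 \<le> 4" by simp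
  qed
  then have 1: "?P (\<lambda>u. (Y (attach G u))\<^sup>2) \<le> 4" by simp
  have "?P (\<lambda>u. ?P (\<lambda>w. (Y (connect G u w))\<^sup>2)) \<le> ?P (\<lambda>u. ?P (\<lambda>w. 2 * B u + 2 * B w))"
  proof (intro expectation_mono_finite[OF fin])
    fix u w assume uw: "u \<in> set_pmf (pref_vertex G)" "w \<in> set_pmf (pref_vertex G)"
    let ?x = "b / real (degree G u)" and ?y = "b / real (degree G w)"
    have "(Y (connect G u w))\<^sup>2 \<le> (?x + ?y)\<^sup>2"
      using power_mono[OF Y_connect(2)[OF uw], of 2] by simp
    also have "\<dots> = 2 * ?x\<^sup>2 + 2 * ?y\<^sup>2 - (?x - ?y)\<^sup>2"
      by (simp only: power2_eq_square) (simp add: algebra_simps)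
    also have "\<dots> \<le> 2 * B u + 2 * B w" by (simp add: B_def)
    finally show "(Y (connect G u w))\<^sup>2 \<le> 2 * B u + 2 * B w" .
  qed
  also have "\<dots> = 4 * ?P B" by (simp add: int)
  \<comment> \<open>Choosing proportionally to the degree cancels one of the two factors
    \<open>1 / k\<close>; the other is at most 1, so each vertex contributes at most
    \<open>b^2 / (2 s)\<close>.\<close>
  also have "?P B \<le> (\<Sum>v\<in>verts G. b\<^sup>2 / (2 * real s))"
    unfolding expectation_pref_vertex[OF adm]
  proof (rule sum_mono)
    fix v
    show "pick_prob s (degree G v) * B v \<le> b\<^sup>2 / (2 * real s)"
    proof (cases "degree G v = 0")
      case False
      then have "pick_prob s (degree G v) * B v = b\<^sup>2 / (2 * real s) / real (degree G v)"
        using s by (simp add: pick_prob_def B_def field_simps power2_eq_square)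
      also have "\<dots> \<le> b\<^sup>2 / (2 * real s) / 1"
        using False s by (intro divide_left_mono) auto
      finally show ?thesis by simp
    qed (simp add: pick_prob_def)
  qed
  finally have 2: "?P (\<lambda>u. ?P (\<lambda>w. (Y (connect G u w))\<^sup>2)) \<le> 2 * b\<^sup>2 / real s * real (num_verts G)"
    by (simp add: num_verts_def field_simps)
  have "measure_pmf.expectation (step p G) (\<lambda>H. (Y H)\<^sup>2) \<le>
      p * 4 + (1 - p) * (2 * b\<^sup>2 / real s * real (num_verts G))"
    unfolding expectation_step[OF adm p] using p 1 2 by (intro add_mono mult_left_mono) auto
  also have "\<dots> \<le> p * 4 + 1 * (2 * b\<^sup>2 / real s * real (num_verts G))"
    using p s by (intro add_mono mult_right_mono) auto
  finally show ?thesis by (simp add: Y_def)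
qed

end

section \<open>The backward recursion for the degree of one vertex\<close>

lemma degree_step_nonneg_le_1:
  assumes "1 \<le> s" "k \<le> 2 * s" "0 \<le> p" "p \<le> 1"
    and c: "\<And>k. k \<le> 2 * Suc s \<Longrightarrow> 0 \<le> c k \<and> c k \<le> 1"
  shows "0 \<le> degree_step p s c k" "degree_step p s c k \<le> 1"
proof -
  define x where "x = pick_prob s k"
  have x: "0 \<le> x" "x \<le> 1" using assms by (auto simp: x_def pick_prob_def)
  note c' = c[of k] c[of "k + 1"] c[of "k + 2"]
  show "0 \<le> degree_step p s c k"
    unfolding degree_step_def Let_def x_def[symmetric] using x assms c' by simp
  have "degree_step p s c k \<le>
     p * ((1 - x) * 1 + x * 1) + (1 - p) * ((1 - x)\<^sup>2 * 1 + 2 * x * (1 - x) * 1 + x\<^sup>2 * 1)"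
    unfolding degree_step_def Let_def x_def[symmetric]
    using x assms(2-4) c' by (intro add_mono mult_left_mono) auto
  also have "\<dots> = 1" by (simp add: power2_eq_square algebra_simps)
  finally show "degree_step p s c k \<le> 1" .
qed

text \<open>In both kinds of step the degree grows with probability at least \<open>x\<close>, and
  growth replaces the bound \<open>B\<close> by at most \<open>B'\<close>. The gain
  \<open>x * (B - B')\<close> is \<open>B / (2 s)\<close> times \<open>k / (k + 1)\<close>, and the
  last factor is at least 1/2.\<close>

lemma degree_step_le_inverse:
  assumes s: "1 \<le> s" and k: "1 \<le> k" "k \<le> 2 * s" and p: "0 \<le> p" "p \<le> 1" and b: "0 \<le> b"
    and c: "\<And>k. 1 \<le> k \<Longrightarrow> k \<le> 2 * Suc s \<Longrightarrow> c k \<le> b / real k"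
  shows "degree_step p s c k \<le> b * (1 - 1 / (4 * real s)) / real k"
proof -
  define x where "x = pick_prob s k"
  have x: "0 \<le> x" "x \<le> 1" using s k by (auto simp: x_def pick_prob_def)
  define B B' where "B = b / real k" and "B' = b / real (k + 1)"
  have B: "B' \<le> B" unfolding B_def B'_def using b k by (intro divide_left_mono) auto
  \<comment> \<open>Weakening the bound at \<open>k + 2\<close> to the one at \<open>k + 1\<close>
    lets vertex-steps and edge-steps share one estimate.\<close>
  have "c (k + 2) \<le> b / real (k + 2)" using k by (intro c) auto
  also have "\<dots> \<le> B'" unfolding B'_def using b k by (intro divide_left_mono) auto
  finally have c': "c (k + 2) \<le> B'" "c (k + 1) \<le> B'" "c k \<le> B"
    using c[of "k + 1"] c[of k] k by (auto simp: B_def B'_def)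
  have "(1 - x)\<^sup>2 * c k + 2 * x * (1 - x) * c (k + 1) + x\<^sup>2 * c (k + 2) \<le>
      (1 - x)\<^sup>2 * B + 2 * x * (1 - x) * B' + x\<^sup>2 * B'"
    using x c' by (intro add_mono mult_left_mono) auto
  also have "\<dots> = (1 - x) * B + x * B' - x * (1 - x) * (B - B')"
    by (simp add: power2_eq_square algebra_simps)
  also have "\<dots> \<le> (1 - x) * B + x * B'" using x B by simp
  finally have edge: "(1 - x)\<^sup>2 * c k + 2 * x * (1 - x) * c (k + 1) + x\<^sup>2 * c (k + 2)
      \<le> (1 - x) * B + x * B'" .
  have vertex: "(1 - x) * c k + x * c (k + 1) \<le> (1 - x) * B + x * B'"
    using x c' by (intro add_mono mult_left_mono) auto
  have "degree_step p s c k \<le> p * ((1 - x) * B + x * B') + (1 - p) * ((1 - x) * B + x * B')"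
    unfolding degree_step_def Let_def x_def[symmetric]
    using p by (intro add_mono[OF mult_left_mono[OF vertex] mult_left_mono[OF edge]]) auto
  also have "\<dots> = B - x * (B - B')" by (simp add: algebra_simps)
  also have "x * (B - B') = b / real k * (1 / (2 * real s)) * (real k / (real k + 1))"
    using k s by (simp add: B_def B'_def x_def pick_prob_def field_simps)
  also have "B - \<dots> \<le> B - b / real k * (1 / (2 * real s)) * (1 / 2)"
    using k b by (intro diff_left_mono mult_left_mono) (auto simp: field_simps)
  finally show ?thesis by (simp add: B_def right_diff_distrib diff_divide_distrib mult_ac)
qed

text \<open>Indexed by the number \<open>j\<close> of remaining steps, so that the recursion is
  primitive. Stage \<open>Suc j\<close> goes from time \<open>t - Suc j\<close>, which fixes the
  total degree, to time \<open>t - j\<close>, which fixes the coin.\<close>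

primrec degree_dist :: "(real \<Rightarrow> real) \<Rightarrow> nat \<Rightarrow> nat \<Rightarrow> nat \<Rightarrow> nat \<Rightarrow> real" where
  "degree_dist f t d 0 = (\<lambda>k. of_bool (k = d))"
| "degree_dist f t d (Suc j) =
     degree_step (f (real (t - j))) (t - Suc j) (degree_dist f t d j)"

text \<open>The probability that a vertex of degree \<open>k\<close> at time \<open>s\<close> has degree \<open>d\<close> at time \<open>t\<close>.\<close>

definition hit_prob :: "(real \<Rightarrow> real) \<Rightarrow> nat \<Rightarrow> nat \<Rightarrow> nat \<Rightarrow> nat \<Rightarrow> real" where
  "hit_prob f t d s = degree_dist f t d (t - s)"

lemma hit_prob_final: "hit_prob f t d t k = of_bool (k = d)"
  by (simp add: hit_prob_def)

lemma hit_prob_Suc: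
  assumes "s < t"
  shows "hit_prob f t d s = degree_step (f (real (Suc s))) s (hit_prob f t d (Suc s))"
proof -
  have "t - s = Suc (t - Suc s)" "t - (t - Suc s) = Suc s" "t - Suc (t - Suc s) = s"
    using assms by auto
  then show ?thesis by (simp add: hit_prob_def)
qed

context
  fixes f :: "real \<Rightarrow> real"
  assumes f: "\<And>x. x \<ge> 1 \<Longrightarrow> 0 \<le> f x \<and> f x \<le> 1"
begin

text \<open>Averaging preserves the bounds, but \<open>pick_prob s k\<close> is a probability only
  for \<open>k <= 2 * s\<close>. The restriction survives a step because
  \<open>k + 2 <= 2 * Suc s\<close>.\<close>

lemma hit_prob_range:
  assumes "1 \<le> s" "s \<le> t" "k \<le> 2 * s"
  shows "0 \<le> hit_prob f t d s k \<and> hit_prob f t d s k \<le> 1"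
  using assms(2,1,3)
proof (induction s arbitrary: k rule: inc_induct)
  case (step s)
  then show ?case
    unfolding hit_prob_Suc[OF step.hyps(2)] using f[of "real (Suc s)"]
    by (intro conjI degree_step_nonneg_le_1) auto
qed (simp add: hit_prob_final)

text \<open>A degree \<open>k\<close> grows at rate at least \<open>k / (2 s)\<close>, which decreases the mean of \<open>1 / k\<close> by a
  factor of at least \<open>1 - 1 / (4 s)\<close> per step; multiplying up gives the fourth root.\<close>

lemma hit_prob_le:
  assumes "1 \<le> s" "s \<le> t" "1 \<le> k" "k \<le> 2 * s"
  shows "hit_prob f t d s k \<le> real d * sqrt (sqrt (real s / real t)) / real k"
  using assms(2,1,3,4)
proof (induction s arbitrary: k rule: inc_induct)
  case base
  \<comment> \<open>At time \<open>t\<close> the root is 1 and both sides agree at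
    \<open>k = d\<close>; this is where the factor \<open>d\<close> comes from.\<close>
  then show ?case by (auto simp: hit_prob_final)
next
  case (step s)
  define q q' where "q = sqrt (sqrt (real s / real t))" and "q' = sqrt (sqrt (real (Suc s) / real t))"
  define u y where "u = 1 / (4 * real s)" and "y = 1 - u"
  have u: "0 \<le> u" "u \<le> 1" using step.prems by (auto simp: u_def)
  then have y: "y \<ge> 0" by (simp add: y_def)
  \<comment> \<open>The aim is \<open>y ^ 4 * (1 + 4 * u) <= 1\<close>, where
    \<open>1 + 4 * u = (s + 1) / s\<close>. It follows by squaring, as
    \<open>(1 + 2 * u)^2 >= 1 + 4 * u\<close>.\<close>
  have "y\<^sup>2 * (1 + 2 * u) = 1 - u\<^sup>2 * (3 - 2 * u)"
    by (simp add: y_def power2_eq_square algebra_simps)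
  also have "\<dots> \<le> 1" using u by simp
  finally have "(y\<^sup>2 * (1 + 2 * u))\<^sup>2 \<le> 1"
    using u by (intro power_le_one) auto
  moreover have "y ^ 4 * (1 + 4 * u) \<le> y ^ 4 * (1 + 2 * u)\<^sup>2"
    by (intro mult_left_mono) (auto simp: power2_eq_square algebra_simps)
  ultimately have "y ^ 4 * (1 + 4 * u) \<le> 1"
    by (simp add: power_mult_distrib flip: power_mult)
  then have "y ^ 4 \<le> 1 / (1 + 4 * u)" using u by (simp add: pos_le_divide_eq)
  also have "\<dots> = real s / real (Suc s)" using step.prems by (simp add: u_def field_simps)
  finally have "sqrt (sqrt (y ^ 4)) \<le> sqrt (sqrt (real s / real (Suc s)))" by simp
  moreover have "sqrt (sqrt (y ^ 4)) = y"
    using y real_sqrt_abs[of "y^2"] by (simp add: power_mult[symmetric])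
  ultimately have "q' * y \<le> q' * sqrt (sqrt (real s / real (Suc s)))"
    by (intro mult_left_mono) (auto simp: q'_def)
  also have "\<dots> = q" by (simp add: q_def q'_def flip: real_sqrt_mult)
  finally have q: "q' * y \<le> q" .
  have "hit_prob f t d s k \<le> real d * q' * y / real k"
    unfolding hit_prob_Suc[OF step.hyps(2)] y_def u_def
    using f[of "real (Suc s)"] step.prems step.IH
    by (intro degree_step_le_inverse) (auto simp: q'_def)
  also have "\<dots> \<le> real d * q / real k"
    using mult_left_mono[OF q, of "real d"] by (intro divide_right_mono) (auto simp: mult.assoc)
  finally show ?case by (simp add: q_def)
qed

end

section \<open>Concentration\<close>

context
  fixes f :: "real \<Rightarrow> real"
  assumes f: "\<And>x. x \<ge> 1 \<Longrightarrow> 0 \<le> f x \<and> f x \<le> 1"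
begin

lemma f_Suc: "0 \<le> f (real (Suc s))" "f (real (Suc s)) \<le> 1"
  using f[of "real (Suc s)"] by auto

section \<open>Mean and lower tail of the number of vertices\<close>

lemma finite_edge_step_graph: "finite (set_pmf (edge_step_graph f s))"
proof (induction s)
  case (Suc s)
  show ?case
  proof (cases "s \<ge> 1")
    case True
    then show ?thesis
      using Suc finite_set_step[OF admissible_edge_step_graph[OF True] f_Suc]
      by (auto simp: edge_step_graph_Suc[OF True])
  next
    case False
    then have "s = 0" by simp
    then show ?thesis by simp
  qed
qed simp

lemma expectation_edge_step_graph_Suc:
  fixes h :: "mgraph \<Rightarrow> real"
  assumes s: "s \<ge> 1"
  shows "measure_pmf.expectation (edge_step_graph f (Suc s)) h =
     measure_pmf.expectation (edge_step_graph f s)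
       (\<lambda>G. measure_pmf.expectation (step (f (real (Suc s))) G) h)"
  unfolding edge_step_graph_Suc[OF s]
  using finite_set_step[OF admissible_edge_step_graph[OF s] f_Suc]
  by (intro expectation_bind_pmf_finite finite_edge_step_graph) auto

lemma expected_num_verts_Suc:
  assumes s: "s \<ge> 1"
  shows "expected_num_verts f (Suc s) = expected_num_verts f s + f (real (Suc s))"
proof -
  have "expected_num_verts f (Suc s) =
     measure_pmf.expectation (edge_step_graph f s) (\<lambda>G. real (num_verts G) + f (real (Suc s)))"
    unfolding expected_num_verts_def expectation_edge_step_graph_Suc[OF s]
    using expectation_num_verts_step[OF admissible_edge_step_graph[OF s] f_Suc]
    by (intro integral_cong_AE) (auto intro: AE_pmfI)
  then show ?thesis
    by (simp add: expected_num_verts_def integrable_measure_pmf_finite[OF finite_edge_step_graph])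
qed

lemma num_verts_initial: "num_verts initial_graph = 1"
  by (simp add: initial_graph_def num_verts_def)

lemma expected_num_verts_1: "expected_num_verts f (Suc 0) = 1"
  by (simp add: expected_num_verts_def num_verts_initial)

lemma expected_num_verts_pos:
  "s \<ge> 1 \<Longrightarrow> expected_num_verts f s \<ge> 1"
proof (induction s rule: nat_induct_at_least)
  case (Suc s)
  then show ?case using f_Suc[of s] by (simp add: expected_num_verts_Suc)
qed (simp add: expected_num_verts_1)

text \<open>Each step multiplies the transform by \<open>1 - p (1 - exp (- 1/2))\<close>, whatever
  the current graph. Since \<open>exp (- 1/2) <= 8/13 <= 5/8\<close>, this factor is at most
  \<open>1 - 3 p / 8\<close>.\<close>

lemma num_verts_laplace:
  assumes "s \<ge> 1"
  shows "measure_pmf.expectation (edge_step_graph f s) (\<lambda>G. exp (- (1/2) * real (num_verts G)))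
           \<le> exp (- (3/8) * expected_num_verts f s)"
  using assms
proof (induction s rule: nat_induct_at_least)
  case base
  show ?case by (simp add: num_verts_initial expected_num_verts_1)
next
  case (Suc s)
  let ?p = "f (real (Suc s))" and ?h = "\<lambda>G. exp (- (1/2) * real (num_verts G))"
  have "exp (- (1/2) :: real) \<le> 1 / (1 + 1/2 + (1/2)\<^sup>2 / 2)"
    using exp_lower_Taylor_quadratic[of "1/2"] by (simp add: exp_minus field_simps)
  also have "\<dots> \<le> 5/8" by (simp add: power2_eq_square)
  finally have e: "exp (- (1/2) :: real) \<le> 5/8" .
  have "measure_pmf.expectation (edge_step_graph f (Suc s)) ?h \<le>
      measure_pmf.expectation (edge_step_graph f s) (\<lambda>G. exp (- (3/8) * ?p) * ?h G)"
    unfolding expectation_edge_step_graph_Suc[OF Suc.hyps]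
  proof (rule expectation_mono_finite[OF finite_edge_step_graph])
    fix G assume "G \<in> set_pmf (edge_step_graph f s)"
    note adm = admissible_edge_step_graph[OF Suc.hyps this]
    have "measure_pmf.expectation (step ?p G) ?h = (1 - ?p * (1 - exp (- (1/2)))) * ?h G"
    proof -
      have "?h (attach G u) = exp (- (1/2)) * ?h G" for u
        by (simp add: num_verts_attach[OF adm] add_divide_distrib flip: exp_add)
      then show ?thesis
        unfolding expectation_step[OF adm f_Suc]
        by (simp only: num_verts_connect[OF adm]) (simp add: algebra_simps)
    qed
    also have "1 - ?p * (1 - exp (- (1/2))) \<le> 1 + - (3/8) * ?p"
      using mult_left_mono[OF e f_Suc(1)[of s]] by (simp add: algebra_simps)
    also have "\<dots> \<le> exp (- (3/8) * ?p)" by (rule exp_ge_add_one_self)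
    finally show "measure_pmf.expectation (step ?p G) ?h \<le> exp (- (3/8) * ?p) * ?h G"
      by simp
  qed
  also have "\<dots> \<le> exp (- (3/8) * ?p) * exp (- (3/8) * expected_num_verts f s)"
    using Suc.IH by simp
  also have "\<dots> = exp (- (3/8) * expected_num_verts f (Suc s))"
    by (simp only: expected_num_verts_Suc[OF Suc.hyps] distrib_left exp_add) simp
  finally show ?case .
qed

text \<open>Markov's inequality for \<open>exp (- V / 2)\<close> at level
  \<open>exp (- F / 4)\<close>; the exponents combine to \<open>- 3/8 + 1/4 = - 1/8\<close>.\<close>

lemma num_verts_lower_tail:
  assumes "s \<ge> 1"
  shows "measure_pmf.prob (edge_step_graph f s) {G. real (num_verts G) < expected_num_verts f s / 2}
           \<le> exp (- expected_num_verts f s / 8)"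
proof -
  let ?F = "expected_num_verts f s" and ?M = "edge_step_graph f s"
  note int = integrable_measure_pmf_finite[OF finite_edge_step_graph]
  have "measure_pmf.prob ?M {G. real (num_verts G) < ?F / 2} \<le>
      measure_pmf.prob ?M {G\<in>space ?M. exp (- (1/2) * real (num_verts G)) \<ge> exp (- ?F / 4)}"
    by (intro measure_pmf.finite_measure_mono) auto
  also have "\<dots> \<le> measure_pmf.expectation ?M (\<lambda>G. exp (- (1/2) * real (num_verts G))) / exp (- ?F / 4)"
    by (intro integral_Markov_inequality_measure[where A = UNIV] int) auto
  also have "\<dots> \<le> exp (- (3/8) * ?F) / exp (- ?F / 4)"
    by (intro divide_right_mono num_verts_laplace assms) auto
  also have "\<dots> = exp (- ?F / 8)" by (simp flip: exp_diff)
  finally show ?thesis .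
qed

section \<open>The Doob martingale of the degree count and its exponential moments\<close>

context
  fixes t d :: nat and r :: real
  assumes r: "0 \<le> r" "r \<le> 1"
begin

text \<open>The sum accounts for future arrivals: a vertex appears at time \<open>j\<close> with
  probability \<open>f j\<close>, has degree 1, and then contributes
  \<open>hit_prob f t d j 1 - r\<close> on average. At \<open>s = t\<close> the sum is empty and the
  count minus \<open>r\<close> times the number of vertices remains.\<close>

definition potential :: "nat \<Rightarrow> mgraph \<Rightarrow> real" where
  "potential s G = degree_sum (hit_prob f t d s) G - r * real (num_verts G)
     + (\<Sum>j\<in>{s<..t}. f (real j) * (hit_prob f t d j 1 - r))"

lemma expectation_potential_step:
  assumes adm: "admissible s G" and s: "s < t"
  shows "measure_pmf.expectation (step (f (real (Suc s))) G) (potential (Suc s)) = potential s G"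
proof -
  let ?p = "f (real (Suc s))"
  let ?h = "\<lambda>s. \<Sum>j\<in>{s<..t}. f (real j) * (hit_prob f t d j 1 - r)"
  note int = integrable_measure_pmf_finite[OF finite_set_step[OF adm f_Suc]]
  have "{s<..t} = insert (Suc s) {Suc s<..t}" using s by auto
  then have h: "?h s = ?p * (hit_prob f t d (Suc s) 1 - r) + ?h (Suc s)" by simp
  have "measure_pmf.expectation (step ?p G) (potential (Suc s)) =
      degree_sum (hit_prob f t d s) G + ?p * hit_prob f t d (Suc s) 1
        - r * (real (num_verts G) + ?p) + ?h (Suc s)"
    unfolding potential_def[abs_def]
    by (simp add: int expectation_degree_sum_step[OF adm f_Suc, of s]
        expectation_num_verts_step[OF adm f_Suc, of s] hit_prob_Suc[OF s] del: of_nat_Suc)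
  also have "\<dots> = potential s G"
    by (simp only: potential_def h) (simp add: algebra_simps)
  finally show ?thesis .
qed

lemma expectation_potential:
  assumes "1 \<le> s" "s \<le> t"
  shows "measure_pmf.expectation (edge_step_graph f s) (potential s) = potential 1 initial_graph"
  using assms
proof (induction s rule: nat_induct_at_least)
  case (Suc s)
  then have "measure_pmf.expectation (edge_step_graph f (Suc s)) (potential (Suc s)) =
      measure_pmf.expectation (edge_step_graph f s) (potential s)"
    unfolding expectation_edge_step_graph_Suc[OF Suc.hyps]
    by (intro integral_cong_AE)
       (auto intro!: AE_pmfI expectation_potential_step admissible_edge_step_graph simp del: of_nat_Suc)
  with Suc show ?case by simp
qed simp

lemma potential_step_mgf:
  assumes adm: "admissible s G" and s: "s < t" and \<theta>: "\<bar>\<theta>\<bar> \<le> 1 / 4"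
  shows "measure_pmf.expectation (step (f (real (Suc s))) G)
           (\<lambda>H. exp (\<theta> * (potential (Suc s) H - potential s G)))
         \<le> exp (\<theta>\<^sup>2 * (4 * f (real (Suc s)) +
              2 * (real d)\<^sup>2 * sqrt (real (Suc s) / real t) / real s * real (num_verts G)))"
proof -
  let ?p = "f (real (Suc s))"
  let ?c = "hit_prob f t d (Suc s)"
  define Y where "Y H = degree_sum ?c H - degree_sum ?c G
    - r * (real (num_verts H) - real (num_verts G))" for H
  \<comment> \<open>\<open>K\<close> is the potential of time \<open>Suc s\<close> evaluated at the
    old graph; subtracting it turns the new potential into the increment \<open>Y\<close>.\<close>
  define K where "K = degree_sum ?c G - r * real (num_verts G)
     + (\<Sum>j\<in>{Suc s<..t}. f (real j) * (hit_prob f t d j 1 - r))"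
  have YK: "Y = (\<lambda>H. potential (Suc s) H - K)"
    by (auto simp: Y_def K_def potential_def algebra_simps)
  have fin: "finite (set_pmf (step ?p G))" by (rule finite_set_step[OF adm f_Suc])
  have EY: "measure_pmf.expectation (step ?p G) Y = potential s G - K"
    using expectation_potential_step[OF adm s]
    by (simp add: YK integrable_measure_pmf_finite[OF fin] del: of_nat_Suc)
  have range: "0 \<le> ?c k \<and> ?c k \<le> 1" if "k \<le> 2 * Suc s" for k
    using that s by (intro hit_prob_range f) auto
  have decay: "?c k \<le> real d * sqrt (sqrt (real (Suc s) / real t)) / real k"
    if "1 \<le> k" "k \<le> 2 * Suc s" for k
    using that s by (intro hit_prob_le f) auto
  have "measure_pmf.expectation (step ?p G)
          (\<lambda>H. exp (\<theta> * (Y H - measure_pmf.expectation (step ?p G) Y)))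
     \<le> exp (\<theta>\<^sup>2 * (4 * ?p + 2 * (real d * sqrt (sqrt (real (Suc s) / real t)))\<^sup>2 / real s
            * real (num_verts G)))"
    unfolding Y_def
    by (intro centred_mgf_bound fin \<theta> step_increment_bound[OF adm f_Suc r range decay]
        step_increment_variance[OF adm f_Suc r range decay])
  then show ?thesis
    unfolding EY by (simp add: YK power_mult_distrib mult.assoc[symmetric] del: of_nat_Suc)
qed

text \<open>Makes the edge-step variances telescope. With \<open>x\<close> and \<open>y\<close> the
  roots of \<open>s\<close> and \<open>s + 1\<close>,
  \<open>1 = (y - x) (y + x) <= 2 y (y - x)\<close>; multiplying by \<open>y\<close> and using
  \<open>s + 1 <= 2 s\<close> gives the constant 4.\<close>

lemma sqrt_increment:
  assumes "1 \<le> s"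
  shows "sqrt (real (Suc s) / real t) / real s
           \<le> 4 * (sqrt (real (Suc s) / real t) - sqrt (real s / real t))"
proof -
  define x y where "x = sqrt (real s)" and "y = sqrt (real (Suc s))"
  have x: "x \<ge> 1" and xy: "x \<le> y" using assms by (auto simp: x_def y_def)
  have sq: "x\<^sup>2 = real s" "y\<^sup>2 = real s + 1" by (simp_all add: x_def y_def)
  have "1 = (y - x) * (y + x)" using sq by (simp add: power2_eq_square algebra_simps)
  also have "\<dots> \<le> (y - x) * (2 * y)" using xy by (intro mult_left_mono) auto
  finally have "y * 1 \<le> y * ((y - x) * (2 * y))" using x xy by (intro mult_left_mono) auto
  also have "\<dots> = 2 * (y - x) * y\<^sup>2" by (simp add: power2_eq_square)
  also have "\<dots> \<le> 2 * (y - x) * (2 * x\<^sup>2)"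
    using xy sq assms by (intro mult_left_mono) auto
  finally have "y / real s \<le> 4 * (y - x)"
    using assms sq by (simp add: field_simps)
  then have "y / real s / sqrt (real t) \<le> 4 * (y - x) / sqrt (real t)"
    by (intro divide_right_mono) auto
  then show ?thesis
    by (simp add: x_def y_def real_sqrt_divide diff_divide_distrib mult.commute)
qed

text \<open>Freedman's argument, except that the predictable variation contributed by the edge-steps is
  dominated along the path by a multiple of the current number of vertices, so that the
  compensator is a function of the current graph alone.\<close>

lemma potential_mgf:
  assumes "1 \<le> s" "s \<le> t" and \<theta>: "\<bar>\<theta>\<bar> \<le> 1 / 4"
  shows "measure_pmf.expectation (edge_step_graph f s)
     (\<lambda>G. exp (\<theta> * (potential s G - potential 1 initial_graph) - \<theta>\<^sup>2 *
        (4 * expected_num_verts f s + 8 * (real d)\<^sup>2 * sqrt (real s / real t) * real (num_verts G))))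
     \<le> 1"
  using assms(1,2)
proof (induction s rule: nat_induct_at_least)
  case base
  show ?case by (simp add: expected_num_verts_1 num_verts_initial)
next
  case (Suc s)
  let ?p = "f (real (Suc s))"
  define D where "D s = 8 * (real d)\<^sup>2 * sqrt (real s / real t)" for s
  define m where "m = potential 1 initial_graph"
  define F where "F s = expected_num_verts f s" for s
  define W where "W s G = exp (\<theta> * (potential s G - m) - \<theta>\<^sup>2 * (4 * F s + D s * real (num_verts G)))"
    for s G
  define q where "q = 2 * (real d)\<^sup>2 * sqrt (real (Suc s) / real t) / real s"
  have s: "s < t" using Suc by simp
  \<comment> \<open>The growth of the coefficient \<open>D\<close> pays for the variance
    \<open>q\<close> per vertex of the current step.\<close>
  have Dq: "D s + q \<le> D (Suc s)"
    using mult_left_mono[OF sqrt_increment[OF Suc.hyps], of "2 * (real d)\<^sup>2"]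
    by (simp add: D_def q_def algebra_simps)
  have D0: "0 \<le> D (Suc s)" by (simp add: D_def)
  have "measure_pmf.expectation (edge_step_graph f (Suc s)) (W (Suc s)) \<le>
        measure_pmf.expectation (edge_step_graph f s) (W s)"
    unfolding expectation_edge_step_graph_Suc[OF Suc.hyps]
  proof (rule expectation_mono_finite[OF finite_edge_step_graph])
    fix G assume "G \<in> set_pmf (edge_step_graph f s)"
    note adm = admissible_edge_step_graph[OF Suc.hyps this]
    have fin: "finite (set_pmf (step ?p G))" by (rule finite_set_step[OF adm f_Suc])
    define B where "B = exp (\<theta> * (potential s G - m)
        - \<theta>\<^sup>2 * (4 * (F s + ?p) + D (Suc s) * real (num_verts G)))"
    have "measure_pmf.expectation (step ?p G) (W (Suc s)) \<le>
        measure_pmf.expectation (step ?p G)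
          (\<lambda>H. B * exp (\<theta> * (potential (Suc s) H - potential s G)))"
    proof (rule expectation_mono_finite[OF fin])
      fix H assume "H \<in> set_pmf (step ?p G)"
      \<comment> \<open>Vertices are never removed, so the compensator at \<open>H\<close> dominates
        the one computed from the old count, which is constant given \<open>G\<close>.\<close>
      then have "num_verts G \<le> num_verts H"
        using set_step[OF adm f_Suc] num_verts_attach[OF adm] num_verts_connect[OF adm] by fastforce
      then have "\<theta>\<^sup>2 * (D (Suc s) * real (num_verts G)) \<le> \<theta>\<^sup>2 * (D (Suc s) * real (num_verts H))"
        using D0 by (intro mult_left_mono) auto
      then show "W (Suc s) H \<le> B * exp (\<theta> * (potential (Suc s) H - potential s G))"
        unfolding W_def B_def F_def expected_num_verts_Suc[OF Suc.hyps]
        by (simp add: algebra_simps flip: exp_add)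
    qed
    also have "\<dots> \<le> B * exp (\<theta>\<^sup>2 * (4 * ?p + q * real (num_verts G)))"
      using potential_step_mgf[OF adm s \<theta>] by (simp add: B_def q_def)
    also have "\<dots> = exp (\<theta> * (potential s G - m)
        - \<theta>\<^sup>2 * (4 * F s + (D (Suc s) - q) * real (num_verts G)))"
      by (simp add: B_def algebra_simps flip: exp_add)
    also have "\<dots> \<le> W s G"
      using Dq by (auto simp: W_def intro!: mult_left_mono mult_right_mono)
    finally show "measure_pmf.expectation (step ?p G) (W (Suc s)) \<le> W s G" .
  qed
  with Suc.IH s have "measure_pmf.expectation (edge_step_graph f (Suc s)) (W (Suc s)) \<le> 1"
    by (simp add: W_def[abs_def] F_def D_def m_def)
  then show ?case by (simp add: W_def[abs_def] F_def D_def m_def)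
qed

text \<open>The threshold scales with the actual number of vertices, as the compensator does, so the
  two can be compared graph by graph; the lower bound on that number then yields a deterministic
  exponent. The sign \<sigma> serves both tails.\<close>

lemma potential_tail:
  assumes t: "1 \<le> t" and d: "1 \<le> d" and y: "0 < y" "y \<le> 1" and \<sigma>: "\<bar>\<sigma>\<bar> = 1"
  shows "measure_pmf.prob (edge_step_graph f t)
     {G. y * real (num_verts G) < \<sigma> * (potential t G - potential 1 initial_graph) \<and>
         expected_num_verts f t / 2 \<le> real (num_verts G)}
     \<le> exp (- (y\<^sup>2 * expected_num_verts f t / (128 * (real d)\<^sup>2)))" (is "measure_pmf.prob ?M ?S \<le> _")
proof -
  define F where "F = expected_num_verts f t"
  \<comment> \<open>On the event the compensator is at most \<open>16 d^2 V\<close> times the square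
    of \<tau>; this choice makes it half of the gain \<tau> \<open>y V\<close>. The remaining half
    is at least \<open>L\<close>, since \<open>V >= F / 2\<close>.\<close>
  define \<tau> where "\<tau> = y / (32 * (real d)\<^sup>2)"
  define L where "L = y\<^sup>2 * F / (128 * (real d)\<^sup>2)"
  have d2: "(real d)\<^sup>2 \<ge> 1" using d by simp
  have \<tau>0: "\<tau> > 0" using y d by (simp add: \<tau>_def)
  have "y / (32 * (real d)\<^sup>2) \<le> 1 / 4"
    using y d2 by (intro frac_le) auto
  then have \<theta>: "\<bar>\<sigma> * \<tau>\<bar> \<le> 1 / 4" using \<sigma> \<tau>0 by (simp add: abs_mult \<tau>_def)
  have sq: "(\<sigma> * \<tau>)\<^sup>2 = \<tau>\<^sup>2" using \<sigma> by (simp add: power_mult_distrib abs_square_eq_1)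
  define W where "W G = exp (\<sigma> * \<tau> * (potential t G - potential 1 initial_graph)
      - \<tau>\<^sup>2 * (4 * F + 8 * (real d)\<^sup>2 * real (num_verts G)))" for G
  have W: "measure_pmf.expectation ?M W \<le> 1"
    using potential_mgf[OF t order_refl \<theta>] t by (simp add: sq W_def[abs_def] F_def)
  have "?S \<subseteq> {G\<in>space ?M. exp L \<le> W G}"
  proof safe
    fix G assume G: "y * real (num_verts G) < \<sigma> * (potential t G - potential 1 initial_graph)"
      "expected_num_verts f t / 2 \<le> real (num_verts G)"
    define V where "V = real (num_verts G)"
    have V: "V \<ge> 0" "F / 2 \<le> V" using G by (simp_all add: V_def F_def)
    have "4 * F + 8 * (real d)\<^sup>2 * V \<le> 8 * V + 8 * (real d)\<^sup>2 * V" using V by simp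
    also have "\<dots> \<le> 8 * (real d)\<^sup>2 * V + 8 * (real d)\<^sup>2 * V"
      using mult_right_mono[OF d2 V(1)] by (simp add: mult.commute)
    finally have "\<tau>\<^sup>2 * (4 * F + 8 * (real d)\<^sup>2 * V) \<le> \<tau>\<^sup>2 * (16 * (real d)\<^sup>2 * V)"
      by (intro mult_left_mono) auto
    also have "\<dots> = \<tau> * (y * V) / 2" using d by (simp add: \<tau>_def field_simps power2_eq_square)
    finally have "\<tau> * (y * V) - \<tau>\<^sup>2 * (4 * F + 8 * (real d)\<^sup>2 * V) \<ge> \<tau> * (y * V) / 2" by linarith
    moreover have "\<tau> * (y * V) \<le> \<tau> * (\<sigma> * (potential t G - potential 1 initial_graph))"
      using G(1) \<tau>0 by (intro mult_left_mono) (auto simp: V_def)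
    moreover have "L \<le> \<tau> * (y * V) / 2"
    proof -
      have "L = \<tau> * y * (F / 2) / 2" by (simp add: L_def \<tau>_def power2_eq_square)
      also have "\<dots> \<le> \<tau> * y * V / 2"
        using V \<tau>0 y by (intro divide_right_mono mult_left_mono) auto
      finally show ?thesis by (simp add: mult.assoc)
    qed
    ultimately show "exp L \<le> W G" by (simp add: W_def V_def mult_ac)
  qed simp
  then have "measure_pmf.prob ?M ?S \<le> measure_pmf.prob ?M {G\<in>space ?M. exp L \<le> W G}"
    by (intro measure_pmf.finite_measure_mono) auto
  also have "\<dots> \<le> measure_pmf.expectation ?M W / exp L"
    by (intro integral_Markov_inequality_measure[where A = UNIV]
        integrable_measure_pmf_finite finite_edge_step_graph) (auto simp: W_def)
  also have "\<dots> \<le> 1 / exp L" using W by (intro divide_right_mono) auto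
  finally show ?thesis by (simp add: L_def F_def exp_minus field_simps)
qed

end

end

section \<open>From the tail bounds to the proportion of vertices of degree \<open>d\<close>\<close>

theorem theorem2:
  fixes f :: "real \<Rightarrow> real" and \<gamma> A :: real and t d :: nat
  assumes "f \<in> RES (- \<gamma>)" and "0 \<le> \<gamma>" and "\<gamma> < 1"
    and "t \<ge> 2" and "d \<ge> 1" and "A > 0"
    and "A < 1 / (4 * real d * ln (real t)) * sqrt (expected_num_verts f t / (1 - \<gamma>))"
  shows "measure_pmf.prob (edge_step_graph f t)
           {G. \<bar>degree_proportion d G
                 - measure_pmf.expectation (edge_step_graph f t)
                     (\<lambda>H. real (num_verts H) * degree_proportion d H)
                   / expected_num_verts f t\<bar>
               \<le> A * (10 * real d / sqrt ((1 - \<gamma>) * expected_num_verts f t))}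
         \<ge> 1 - 3 * exp (- (A\<^sup>2 / 3))"
proof -
  define M where "M = edge_step_graph f t"
  define F where "F = expected_num_verts f t"
  define V where "V G = real (num_verts G)" for G
  define P where "P = degree_proportion d"
  define r where "r = measure_pmf.expectation M (\<lambda>H. V H * P H) / F"
  define X where "X G = V G * P G - r * V G" for G
  \<comment> \<open>The permitted error with \<open>1 - \<gamma>\<close> replaced by 1, which can
    only make it smaller.\<close>
  define y where "y = 10 * A * real d / sqrt F"
  have f: "0 \<le> f x \<and> f x \<le> 1" if "x \<ge> 1" for x
    using assms(1) that by (auto simp: RES_def)
  have t: "1 \<le> t" using assms by simp
  have F: "F \<ge> 1" unfolding F_def using expected_num_verts_pos[OF f t] by simp
  have fin: "finite (set_pmf M)" unfolding M_def by (rule finite_edge_step_graph[OF f])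
  note int = integrable_measure_pmf_finite[OF fin]
  have FV: "F = measure_pmf.expectation M V"
    by (simp add: F_def M_def expected_num_verts_def V_def[abs_def])
  have graph: "V G \<ge> 1" "0 \<le> P G" "P G \<le> 1"
    "V G * P G = degree_sum (hit_prob f t d t) G" if "G \<in> set_pmf M" for G
  proof -
    have adm: "admissible t G" using that t admissible_edge_step_graph by (auto simp: M_def)
    have fG: "finite (verts G)" by (rule adm_facts[OF adm])
    show V1: "V G \<ge> 1"
      using edge_step_graph_invariant(2)[OF t] that by (simp add: V_def M_def)
    have "card {v \<in> verts G. degree G v = d} \<le> num_verts G"
      unfolding num_verts_def by (intro card_mono fG) auto
    then show "0 \<le> P G" "P G \<le> 1"
      using V1 by (auto simp: P_def degree_proportion_def V_def)
    have "degree_sum (hit_prob f t d t) G = real (card {v \<in> verts G. degree G v = d})"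
      using fG by (simp add: degree_sum_def hit_prob_final Int_def)
    then show "V G * P G = degree_sum (hit_prob f t d t) G"
      using V1 by (simp add: P_def degree_proportion_def V_def)
  qed
  have r: "0 \<le> r" "r \<le> 1"
  proof -
    have "measure_pmf.expectation M (\<lambda>H. 0) \<le> measure_pmf.expectation M (\<lambda>H. V H * P H)"
      using graph by (intro expectation_mono_finite[OF fin]) (fastforce simp: V_def)
    then show "0 \<le> r" using F by (simp add: r_def)
    have "measure_pmf.expectation M (\<lambda>H. V H * P H) \<le> F"
      unfolding FV using graph
      by (intro expectation_mono_finite[OF fin] mult_left_le) (auto simp: V_def)
    then show "r \<le> 1" using F by (simp add: r_def)
  qed
  have pot: "potential f t d r t G = X G" if "G \<in> set_pmf M" for G
    using graph(4)[OF that] by (simp add: potential_def[OF f r] X_def V_def)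
  have "potential f t d r 1 initial_graph = measure_pmf.expectation M (potential f t d r t)"
    using expectation_potential[OF f r t order_refl] by (simp add: M_def)
  also have "\<dots> = measure_pmf.expectation M X"
    using pot by (intro integral_cong_AE) (auto intro: AE_pmfI)
  \<comment> \<open>The ratio \<open>r\<close> is chosen so that this mean vanishes.\<close>
  also have "\<dots> = 0"
    using F by (simp add: X_def[abs_def] int r_def FV[symmetric])
  finally have pot1: "potential f t d r 1 initial_graph = 0" .
  have y0: "y > 0" using assms F by (simp add: y_def)
  have y_le: "y \<le> A * (10 * real d / sqrt ((1 - \<gamma>) * F))"
  proof -
    have "(1 - \<gamma>) * F \<le> 1 * F" using assms F by (intro mult_right_mono) auto
    then have "10 * A * real d / sqrt F \<le> 10 * A * real d / sqrt ((1 - \<gamma>) * F)"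
      using assms F by (intro divide_left_mono) auto
    then show ?thesis by (simp add: y_def mult_ac)
  qed
  define bad where "bad = {G. \<not> \<bar>P G - r\<bar> \<le> A * (10 * real d / sqrt ((1 - \<gamma>) * F))}"
  have dev: "\<bar>P G - r\<bar> > y" if "G \<in> bad" for G
    using that y_le by (simp add: bad_def)
  have "measure_pmf.prob M bad \<le> 3 * exp (- (A\<^sup>2 / 3))"
  proof (cases "y \<le> 1")
    case False
    \<comment> \<open>Both \<open>P G\<close> and \<open>r\<close> lie between 0 and 1, so they
      cannot differ by more than \<open>y > 1\<close>.\<close>
    have "G \<notin> bad" if "G \<in> set_pmf M" for G
      using dev[of G] graph[OF that] r False by linarith
    then have "measure_pmf.prob M bad = 0"
      by (subst measure_pmf_zero_iff) auto
    then show ?thesis by simp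
  next
    case True
    define S where "S \<sigma> = {G. y * V G < \<sigma> * (potential f t d r t G - potential f t d r 1 initial_graph)
        \<and> F / 2 \<le> V G}" for \<sigma>
    define L where "L = {G. V G < F / 2}"
    have y2: "y\<^sup>2 = 100 * A\<^sup>2 * (real d)\<^sup>2 / F"
      using F by (simp add: y_def power_divide power_mult_distrib)
    have S: "measure_pmf.prob M (S \<sigma>) \<le> exp (- (A\<^sup>2 / 3))" if "\<bar>\<sigma>\<bar> = 1" for \<sigma>
    proof -
      have "measure_pmf.prob M (S \<sigma>) \<le> exp (- (y\<^sup>2 * F / (128 * (real d)\<^sup>2)))"
        unfolding S_def M_def F_def V_def
        by (rule potential_tail[OF f r t assms(5) y0 True that])
      \<comment> \<open>The factor 10 in the error gives \<open>100 / 128\<close>, which exceeds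
        \<open>1 / 3\<close>.\<close>
      also have "y\<^sup>2 * F / (128 * (real d)\<^sup>2) = 100 / 128 * A\<^sup>2"
        using F assms(5) by (simp add: y2)
      finally show ?thesis by (rule order_trans) simp
    qed
    have L: "measure_pmf.prob M L \<le> exp (- (A\<^sup>2 / 3))"
    proof -
      \<comment> \<open>The case assumption bounds \<open>A^2\<close> by \<open>F / 100\<close>, so
        the exponent \<open>F / 8\<close> of the vertex count exceeds
        \<open>A^2 / 3\<close>.\<close>
      have "y\<^sup>2 \<le> 1" using y0 True by (simp add: power_le_one)
      then have "100 * A\<^sup>2 * (real d)\<^sup>2 \<le> F" using F by (simp add: y2)
      moreover have "A\<^sup>2 * 1 \<le> A\<^sup>2 * (real d)\<^sup>2"
        using assms(5) by (intro mult_left_mono) auto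
      ultimately have "A\<^sup>2 / 3 \<le> F / 8" using zero_le_power2[of A] by linarith
      then show ?thesis
        unfolding L_def M_def F_def V_def
        by (intro order_trans[OF num_verts_lower_tail[OF f t]]) auto
    qed
    have "bad \<inter> set_pmf M \<subseteq> S 1 \<union> S (- 1) \<union> L"
    proof
      fix G assume G: "G \<in> bad \<inter> set_pmf M"
      then have V: "V G \<ge> 1" using graph by auto
      \<comment> \<open>Multiplying by the number of vertices turns a deviation of the proportion
        into one of \<open>X\<close>, the final value of the martingale.\<close>
      have "V G * y < V G * \<bar>P G - r\<bar>" using dev[of G] G V by simp
      also have "\<dots> = \<bar>V G * (P G - r)\<bar>" using V by (simp add: abs_mult)
      also have "\<dots> = \<bar>X G\<bar>" by (simp add: X_def algebra_simps)
      finally show "G \<in> S 1 \<union> S (- 1) \<union> L"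
        using pot[of G] pot1 G by (auto simp: S_def L_def mult.commute abs_if split: if_splits)
    qed
    then have "measure_pmf.prob M (bad \<inter> set_pmf M) \<le> measure_pmf.prob M (S 1 \<union> S (- 1) \<union> L)"
      by (intro measure_pmf.finite_measure_mono) auto
    also have "\<dots> \<le> measure_pmf.prob M (S 1) + measure_pmf.prob M (S (- 1)) + measure_pmf.prob M L"
      by (intro order_trans[OF measure_Un_le] add_mono measure_Un_le) auto
    also have "\<dots> \<le> 3 * exp (- (A\<^sup>2 / 3))" using S[of 1] S[of "- 1"] L by simp
    finally show ?thesis by (simp add: measure_Int_set_pmf)
  qed
  moreover have "measure_pmf.prob M (UNIV - bad) = 1 - measure_pmf.prob M bad"
    using measure_pmf.prob_compl[of bad M] by simp
  moreover have "UNIV - bad = {G. \<bar>P G - r\<bar> \<le> A * (10 * real d / sqrt ((1 - \<gamma>) * F))}"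
    by (auto simp: bad_def)
  ultimately show ?thesis
    by (simp add: M_def F_def P_def r_def V_def)
qed

end
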